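(* Let $(\mathscr{A},\langle\cdot,\cdot\rangle)$ be a finite-dimensional real metric Jordan algebra and let $\{E_i\}$ be an orthonormal basis of it. Then the Jordan Ricci curvature tensor satisfies, for all $X,Y\in\mathscr{A}$, $$\operatorname{Ric}(X,Y)=-\frac12\sum_{i,j}\langle XE_i,E_j\rangle\langle YE_i,E_j\rangle+\frac14\sum_{i,j}\langle E_iE_j,X\rangle\langle E_iE_j,Y\rangle+\frac12B(X,Y)-\frac14\langle H,XY\rangle,$$ where $B$ is the Killing form of $\mathscr{A}$ and $H$ is the mean curvature vector of $(\mathscr{A},\langle\cdot,\cdot\rangle)$.
   Context: A (real) Jordan algebra is a real vector space $\mathscr{A}$ with a bilinear product satisfying $XY=YX$ and $X(X^2Y)=X^2(XY)$. A metric Jordan algebra is a Jordan algebra with an arbitrary (positive definite) inner product $\langle\cdot,\cdot\rangle$. Its Jordan-Levi-Civita connection is the unique bilinear map $(X,Y)\mapsto\nabla_XY$ from $\mathscr{A}\times\mathscr{A}$ to $\mathscr{A}$ with $\nabla_XY+\nabla_YX=XY$ and $\langle\nabla_XY,Z\rangle=\langle Y,\nabla_XZ\rangle$ for all $X,Y,Z$; explicitly $\langle\nabla_XY,Z\rangle=\frac12(\langle XY,Z\rangle-\langle YZ,X\rangle+\langle ZX,Y\rangle)$. The Jordan curvature tensor is $R(X,Y)Z=-\nabla_X\nabla_YZ-\nabla_Y\nabla_XZ+\nabla_{XY}Z$. Put $\operatorname{ric}(U,V)=\operatorname{Tr}(X\mapsto R(U,X)V)$; the Jordan Ricci curvature tensor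 is $\operatorname{Ric}(U,V)=\frac12(\operatorname{ric}(U,V)+\operatorname{ric}(V,U))$. With $L_X(Y)=XY$, the Killing form is $B(X,Y)=\operatorname{Tr}(L_XL_Y)$. The mean curvature vector is $H=\sum_iE_i^2$ for any orthonormal basis $\{E_i\}$ (independent of the choice). *)

theory Defs
  imports "HOL-Analysis.Analysis"
begin

locale jordan_algebra =
  fixes mul :: "'a::real_vector \<Rightarrow> 'a \<Rightarrow> 'a"
  assumes bilinear_mul: "bilinear mul"
    and commute: "mul x y = mul y x"
    and jordan_identity: "mul x (mul (mul x x) y) = mul (mul x x) (mul x y)"

text \<open>
  The inner product of a metric Jordan algebra is the one of the class \<open>real_inner\<close>. It is not
  related to the product in any way. In contrast to \<open>euclidean_space\<close>, finite dimension stated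
  explicitly for a \<open>real_inner\<close> type also admits the zero algebra.
\<close>

definition finite_dim :: "'a::real_vector itself \<Rightarrow> bool"
  where "finite_dim (_ :: 'a itself) \<longleftrightarrow> (\<exists>S :: 'a set. finite S \<and> span S = UNIV)"

locale metric_jordan_algebra = jordan_algebra mul
  for mul :: "'a::real_inner \<Rightarrow> 'a \<Rightarrow> 'a"

locale fd_metric_jordan_algebra = metric_jordan_algebra mul
  for mul :: "'a::real_inner \<Rightarrow> 'a \<Rightarrow> 'a" +
  assumes finite_dim: "finite_dim TYPE('a)"

definition orthonormal_basis :: "'a::real_inner set \<Rightarrow> bool"
  where "orthonormal_basis B \<longleftrightarrow>
    pairwise orthogonal B \<and> (\<forall>b\<in>B. norm b = 1) \<and> span B = UNIV"

text \<open>
  The trace of an endomorphism of a finite-dimensional space: the sum of the diagonal entries of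
  its matrix with respect to some basis; see \<open>endo_trace_eq\<close> for the independence of the basis.
\<close>

definition endo_trace :: "('a::real_vector \<Rightarrow> 'a) \<Rightarrow> real"
  where "endo_trace f =
    (let B = (SOME B. independent B \<and> span B = UNIV) in \<Sum>b\<in>B. representation B (f b) b)"

definition is_jordan_levi_civita ::
    "('a::real_inner \<Rightarrow> 'a \<Rightarrow> 'a) \<Rightarrow> ('a \<Rightarrow> 'a \<Rightarrow> 'a) \<Rightarrow> bool"
  where "is_jordan_levi_civita mul D \<longleftrightarrow>
    bilinear D \<and>
    (\<forall>x y. D x y + D y x = mul x y) \<and>
    (\<forall>x y z. D x y \<bullet> z = y \<bullet> D x z)"

text \<open>Well-defined by \<open>fd_metric_jordan_algebra.ex1_jordan_levi_civita\<close>.\<close>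

definition jordan_levi_civita :: "('a::real_inner \<Rightarrow> 'a \<Rightarrow> 'a) \<Rightarrow> 'a \<Rightarrow> 'a \<Rightarrow> 'a"
  where "jordan_levi_civita mul = (THE D. is_jordan_levi_civita mul D)"

definition jordan_curvature :: "('a::real_inner \<Rightarrow> 'a \<Rightarrow> 'a) \<Rightarrow> 'a \<Rightarrow> 'a \<Rightarrow> 'a \<Rightarrow> 'a"
  where "jordan_curvature mul x y z =
    (let D = jordan_levi_civita mul in - D x (D y z) - D y (D x z) + D (mul x y) z)"

definition jordan_ric :: "('a::real_inner \<Rightarrow> 'a \<Rightarrow> 'a) \<Rightarrow> 'a \<Rightarrow> 'a \<Rightarrow> real"
  where "jordan_ric mul u v = endo_trace (\<lambda>x. jordan_curvature mul u x v)"

definition jordan_Ricci :: "('a::real_inner \<Rightarrow> 'a \<Rightarrow> 'a) \<Rightarrow> 'a \<Rightarrow> 'a \<Rightarrow> real"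
  where "jordan_Ricci mul u v = 1/2 * (jordan_ric mul u v + jordan_ric mul v u)"

definition killing_form :: "('a::real_vector \<Rightarrow> 'a \<Rightarrow> 'a) \<Rightarrow> 'a \<Rightarrow> 'a \<Rightarrow> real"
  where "killing_form mul x y = endo_trace (mul x \<circ> mul y)"

text \<open>See \<open>fd_metric_jordan_algebra.mean_curvature_eq\<close> for the independence of the basis.\<close>

definition mean_curvature :: "('a::real_inner \<Rightarrow> 'a \<Rightarrow> 'a) \<Rightarrow> 'a"
  where "mean_curvature mul = (\<Sum>e\<in>(SOME B. orthonormal_basis B). mul e e)"

lemma finite_dim_finite_independent:
  fixes B :: "'a::real_vector set"
  assumes "finite_dim TYPE('a)" "independent B"
  shows "finite B"
  using assms independent_span_bound unfolding finite_dim_def by blast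

lemma representation_sum_scale:
  fixes f :: "'a::real_vector \<Rightarrow> 'a"
  assumes "independent B" "span B = UNIV" "finite C"
  shows "representation B (\<Sum>c\<in>C. r c *\<^sub>R g c) b = (\<Sum>c\<in>C. r c * representation B (g c) b)"
  using assms by (subst real_vector.representation_sum)
    (auto simp: real_vector.representation_scale)

lemma endo_trace_eq:
  fixes f :: "'a::real_vector \<Rightarrow> 'a"
  assumes fd: "finite_dim TYPE('a)" and f: "linear f"
    and C: "independent C" "span C = UNIV"
  shows "endo_trace f = (\<Sum>c\<in>C. representation C (f c) c)"
proof -
  define B :: "'a set" where "B = (SOME B. independent B \<and> span B = UNIV)"
  have "independent B \<and> span B = UNIV"
    unfolding B_def by (rule someI[of _ C]) (use C in auto)
  then have B: "independent B" "span B = UNIV" by auto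
  have fin: "finite B" "finite C"
    using finite_dim_finite_independent[OF fd] B C by auto
  have expB: "(\<Sum>b\<in>B. representation B v b *\<^sub>R b) = v" for v
    using B fin by (intro real_vector.sum_representation_eq) auto
  have expC: "(\<Sum>c\<in>C. representation C v c *\<^sub>R c) = v" for v
    using C fin by (intro real_vector.sum_representation_eq) auto
  have fC: "f b = (\<Sum>c\<in>C. representation C b c *\<^sub>R f c)" for b
    using linear_sum[OF f, of "\<lambda>c. representation C b c *\<^sub>R c" C] linear_scale[OF f]
    by (simp add: expC)
  have "(\<Sum>b\<in>B. representation B (f b) b)
      = (\<Sum>b\<in>B. \<Sum>c\<in>C. representation C b c * representation B (f c) b)"
    by (subst fC) (simp add: representation_sum_scale[OF B fin(2)])
  also have "\<dots> = (\<Sum>c\<in>C. \<Sum>b\<in>B. representation B (f c) b * representation C b c)"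
    by (subst sum.swap) (simp add: mult.commute)
  also have "\<dots> = (\<Sum>c\<in>C. representation C (\<Sum>b\<in>B. representation B (f c) b *\<^sub>R b) c)"
    by (simp add: representation_sum_scale[OF C fin(1)])
  also have "\<dots> = (\<Sum>c\<in>C. representation C (f c) c)"
    by (simp add: expB)
  finally show ?thesis
    unfolding endo_trace_def B_def by (simp add: Let_def)
qed

lemma orthonormal_basis_independent:
  assumes "orthonormal_basis B"
  shows "independent B"
  using assms unfolding orthonormal_basis_def
  by (intro pairwise_orthogonal_independent) auto

lemma orthonormal_basis_finite:
  fixes B :: "'a::real_inner set"
  assumes "finite_dim TYPE('a)" "orthonormal_basis B"
  shows "finite B"
  using assms finite_dim_finite_independent orthonormal_basis_independent by blast

lemma inner_orthonormal_basis:
  assumes "orthonormal_basis B" "b \<in> B" "c \<in> B"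
  shows "b \<bullet> c = (if b = c then 1 else 0)"
  using assms unfolding orthonormal_basis_def pairwise_def orthogonal_def
  by (auto simp: norm_eq_1)

lemma representation_orthonormal_basis:
  fixes B :: "'a::real_inner set"
  assumes "finite_dim TYPE('a)" "orthonormal_basis B" "b \<in> B"
  shows "representation B v b = v \<bullet> b"
proof -
  have B: "independent B" "span B = UNIV" "finite B"
    using assms orthonormal_basis_independent orthonormal_basis_finite
    by (auto simp: orthonormal_basis_def)
  have "v \<bullet> b = (\<Sum>c\<in>B. representation B v c *\<^sub>R c) \<bullet> b"
    using B by (subst real_vector.sum_representation_eq) auto
  also have "\<dots> = (\<Sum>c\<in>B. if c = b then representation B v c else 0)"
    using assms by (auto simp: inner_sum_left inner_orthonormal_basis intro!: sum.cong)
  finally show ?thesis using B assms by simp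
qed

lemma orthonormal_basis_expand_inner:
  fixes B :: "'a::real_inner set"
  assumes "finite_dim TYPE('a)" "orthonormal_basis B"
  shows "(\<Sum>b\<in>B. (v \<bullet> b) *\<^sub>R b) = v"
proof -
  have B: "independent B" "span B = UNIV" "finite B"
    using assms orthonormal_basis_independent orthonormal_basis_finite
    by (auto simp: orthonormal_basis_def)
  have "(\<Sum>b\<in>B. (v \<bullet> b) *\<^sub>R b) = (\<Sum>b\<in>B. representation B v b *\<^sub>R b)"
    using assms by (auto simp: representation_orthonormal_basis intro!: sum.cong)
  then show ?thesis using B by (simp add: real_vector.sum_representation_eq)
qed

lemma endo_trace_orthonormal:
  fixes f :: "'a::real_inner \<Rightarrow> 'a"
  assumes "finite_dim TYPE('a)" "linear f" "orthonormal_basis B"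
  shows "endo_trace f = (\<Sum>b\<in>B. f b \<bullet> b)"
proof -
  have "span B = UNIV"
    using assms(3) by (simp add: orthonormal_basis_def)
  then show ?thesis
    using assms orthonormal_basis_independent[OF assms(3)]
    by (simp add: endo_trace_eq[of f B] representation_orthonormal_basis)
qed

lemma ex_orthonormal_basis:
  assumes "finite_dim TYPE('a::real_inner)"
  shows "\<exists>B :: 'a set. orthonormal_basis B"
proof -
  from assms obtain S :: "'a set" where "finite S" "span S = UNIV"
    by (auto simp: finite_dim_def)
  with basis_orthogonal obtain C :: "'a set"
    where C: "finite C" "span C = UNIV" "pairwise orthogonal C" by metis
  define B where "B = (\<lambda>x. x /\<^sub>R norm x) ` (C - {0})"
  have "span C \<subseteq> span B"
  proof (rule span_minimal)
    show "C \<subseteq> span B"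
    proof
      fix x assume x: "x \<in> C"
      show "x \<in> span B"
      proof (cases "x = 0")
        case False
        with x have "x /\<^sub>R norm x \<in> span B" by (auto simp: B_def intro!: span_base)
        then have "norm x *\<^sub>R (x /\<^sub>R norm x) \<in> span B" by (rule span_scale)
        with False show ?thesis by simp
      qed (simp add: span_zero)
    qed
  qed simp
  with C have "orthonormal_basis B"
    unfolding orthonormal_basis_def B_def pairwise_def orthogonal_def by auto
  then show ?thesis ..
qed

context fd_metric_jordan_algebra
begin

lemma jordan_levi_civita_unique:
  assumes "is_jordan_levi_civita mul D"
  shows "D x y \<bullet> z = 1/2 * (mul x y \<bullet> z - mul y z \<bullet> x + mul z x \<bullet> y)"
proof -
  have sym: "D x y + D y x = mul x y" for x y
    using assms by (auto simp: is_jordan_levi_civita_def)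
  have met: "D x y \<bullet> z = D x z \<bullet> y" for x y z
    using assms by (auto simp: is_jordan_levi_civita_def inner_commute)
  have "mul x y \<bullet> z = D x y \<bullet> z + D y x \<bullet> z" "mul y z \<bullet> x = D y z \<bullet> x + D z y \<bullet> x"
    "mul z x \<bullet> y = D z x \<bullet> y + D x z \<bullet> y"
    by (simp_all flip: sym inner_add_left)
  then show ?thesis using met[of x y z] met[of y x z] met[of z x y] by simp
qed

lemma ex1_jordan_levi_civita: "\<exists>!D. is_jordan_levi_civita mul D"
proof -
  obtain B :: "'a set" where B: "orthonormal_basis B"
    using ex_orthonormal_basis[OF finite_dim] by blast
  define F where "F x y z = 1/2 * (mul x y \<bullet> z - mul y z \<bullet> x + mul z x \<bullet> y)" for x y z
  define D where "D x y = (\<Sum>b\<in>B. F x y b *\<^sub>R b)" for x y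
  note bl = bilinear_ladd[OF bilinear_mul] bilinear_radd[OF bilinear_mul]
    bilinear_lmul[OF bilinear_mul] bilinear_rmul[OF bilinear_mul]
  have Fadd: "F (a + b) y z = F a y z + F b y z" "F x (a + b) z = F x a z + F x b z"
     "F x y (a + b) = F x y a + F x y b" for a b x y z
    by (simp_all add: F_def bl algebra_simps inner_simps add_divide_distrib diff_divide_distrib)
  have Fscale: "F (c *\<^sub>R a) y z = c * F a y z" "F x (c *\<^sub>R a) z = c * F x a z"
     "F x y (c *\<^sub>R a) = c * F x y a" for c a x y z
    by (simp_all add: F_def bl algebra_simps)
  have lin: "linear (F x y)" for x y
    by (rule linearI) (simp_all add: Fadd Fscale)
  have DF: "D x y \<bullet> z = F x y z" for x y z
  proof -
    have "F x y z = F x y (\<Sum>b\<in>B. (z \<bullet> b) *\<^sub>R b)"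
      by (simp add: orthonormal_basis_expand_inner[OF finite_dim B])
    also have "\<dots> = (\<Sum>b\<in>B. (z \<bullet> b) * F x y b)"
      by (simp add: linear_sum[OF lin] Fscale)
    also have "\<dots> = D x y \<bullet> z"
      by (simp add: D_def inner_sum_left inner_commute[of z] mult.commute)
    finally show ?thesis by simp
  qed
  have eqI: "u = v" if "\<And>z. u \<bullet> z = v \<bullet> z" for u v :: 'a
    using that vector_eq_rdot by blast
  have "is_jordan_levi_civita mul D"
    unfolding is_jordan_levi_civita_def bilinear_def
  proof (intro conjI allI linearI)
    fix x y z :: 'a
    show "D x y + D y x = mul x y"
      by (rule eqI) (simp add: inner_add_left DF F_def commute field_simps)
    show "D x y \<bullet> z = y \<bullet> D x z"
      by (simp add: DF inner_commute[of y] F_def commute)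
  qed (rule eqI, simp add: inner_add_left DF Fadd Fscale)+
  moreover have "D' = D''" if "is_jordan_levi_civita mul D'" "is_jordan_levi_civita mul D''" for D' D''
    using that by (intro ext eqI) (simp add: jordan_levi_civita_unique)
  ultimately show ?thesis by blast
qed

lemma jordan_levi_civita:
  "is_jordan_levi_civita mul (jordan_levi_civita mul)"
  unfolding jordan_levi_civita_def by (rule theI'[OF ex1_jordan_levi_civita])

lemma jordan_levi_civita_explicit:
  "jordan_levi_civita mul x y \<bullet> z = 1/2 * (mul x y \<bullet> z - mul y z \<bullet> x + mul z x \<bullet> y)"
  by (rule jordan_levi_civita_unique[OF jordan_levi_civita])

lemma mean_curvature_eq:
  assumes C: "orthonormal_basis C"
  shows "mean_curvature mul = (\<Sum>e\<in>C. mul e e)"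
proof -
  define B :: "'a set" where "B = (SOME B. orthonormal_basis B)"
  have B: "orthonormal_basis B"
    unfolding B_def by (rule someI[of _ C]) (rule C)
  note expB = orthonormal_basis_expand_inner[OF finite_dim B]
  note expC = orthonormal_basis_expand_inner[OF finite_dim C]
  have lin: "linear (mul x)" "linear (\<lambda>x. mul x y)" for x y
    using bilinear_mul by (auto simp: bilinear_def)
  have e1: "mul b y = (\<Sum>c\<in>C. (b \<bullet> c) *\<^sub>R mul c y)" for b y
    using linear_sum[OF lin(2)[of y], of "\<lambda>c. (b \<bullet> c) *\<^sub>R c" C] linear_scale[OF lin(2)]
    by (simp add: expC)
  have e2: "mul x c = (\<Sum>b\<in>B. (c \<bullet> b) *\<^sub>R mul x b)" for x c
    using linear_sum[OF lin(1)[of x], of "\<lambda>b. (c \<bullet> b) *\<^sub>R b" B] linear_scale[OF lin(1)]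
    by (simp add: expB)
  have "(\<Sum>b\<in>B. mul b b) = (\<Sum>b\<in>B. \<Sum>c\<in>C. (b \<bullet> c) *\<^sub>R mul c b)"
    by (subst e1) simp
  also have "\<dots> = (\<Sum>c\<in>C. \<Sum>b\<in>B. (c \<bullet> b) *\<^sub>R mul c b)"
    by (subst sum.swap) (simp add: inner_commute)
  also have "\<dots> = (\<Sum>c\<in>C. mul c c)"
    by (simp flip: e2)
  finally show ?thesis unfolding mean_curvature_def B_def .
qed

end

end

theory Submission
  imports Defs
begin

text \<open>
  Write \<open>D\<close> for the Jordan-Levi-Civita connection. Every \<open>D x\<close> is self-adjoint and
  \<open>2 (D e e) = e e\<close>, so in the trace of \<open>x \<mapsto> R(U, x) V\<close> over an orthonormal basis the term
  \<open>- D e (D U V)\<close> contributes \<open>- (H \<bullet> D U V) / 2\<close>. In the matrix entries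
  \<open>u e f = (U e) \<bullet> f\<close>, \<open>v e f = (V e) \<bullet> f\<close> and the symmetric entries
  \<open>s e f = (e f) \<bullet> U\<close>, \<open>t e f = (e f) \<bullet> V\<close>, the other two terms contribute the sums over
  \<open>e, f\<close> of
  \<open>- (v e f - v f e + t e f) (u e f + u f e - s e f) / 4\<close> and
  \<open>u e f (v f e - v e f + t e f) / 2\<close>.
  The sum of an antisymmetric matrix times a symmetric one vanishes, and the mixed products
  of \<open>t\<close> and \<open>u\<close> cancel between the two terms; what survives is the products of \<open>u\<close> and \<open>v\<close>
  (giving the Killing form and the first sum of the theorem) and of \<open>s\<close> and \<open>t\<close>. This is the lemma
  \<open>jordan_ric_eq\<close>. Its only part that is not symmetric in \<open>U\<close> and \<open>V\<close> is \<open>H \<bullet> D U V\<close>, and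
  \<open>D U V + D V U = U V\<close> turns the symmetrization of that part into \<open>H \<bullet> U V\<close>.
\<close>

lemma inner_orthonormal_expansion:
  fixes x y :: "'a::real_inner"
  assumes "finite_dim TYPE('a)" "orthonormal_basis E"
  shows "x \<bullet> y = (\<Sum>e\<in>E. (x \<bullet> e) * (y \<bullet> e))"
proof -
  have "x \<bullet> y = x \<bullet> (\<Sum>e\<in>E. (y \<bullet> e) *\<^sub>R e)"
    by (simp add: orthonormal_basis_expand_inner[OF assms])
  also have "\<dots> = (\<Sum>e\<in>E. (x \<bullet> e) * (y \<bullet> e))"
    by (simp add: inner_sum_right mult.commute)
  finally show ?thesis .
qed

text \<open>
  The cancellation behind the Ricci formula, separated from its geometric origin. Exchanging the
  two summation indices replaces \<open>u e f\<close> by \<open>u f e\<close> at will, which makes the products of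
  \<open>v e f - v f e\<close> with symmetric entries vanish.
\<close>

lemma sum_matrix_cancellation:
  fixes u v s t :: "'a \<Rightarrow> 'a \<Rightarrow> real"
  assumes s: "\<And>e f. s e f = s f e" and t: "\<And>e f. t e f = t f e"
  shows "(\<Sum>e\<in>E. \<Sum>f\<in>E. - 1/4 * ((v e f - v f e + t e f) * (u e f + u f e - s e f))
            + 1/2 * (u e f * (v f e - v e f + t e f)))
    = - 1/2 * (\<Sum>e\<in>E. \<Sum>f\<in>E. u e f * v e f) + 1/4 * (\<Sum>e\<in>E. \<Sum>f\<in>E. s e f * t e f)
      + 1/2 * (\<Sum>e\<in>E. \<Sum>f\<in>E. u f e * v e f)"
proof -
  define S where "S g = (\<Sum>e\<in>E. \<Sum>f\<in>E. g e f)" for g :: "'a \<Rightarrow> 'a \<Rightarrow> real"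
  have swap: "S g = S (\<lambda>e f. g f e)" for g
    unfolding S_def by (rule sum.swap)
  have add: "S (\<lambda>e f. g e f + h e f) = S g + S h"
    and diff: "S (\<lambda>e f. g e f - h e f) = S g - S h"
    and scale: "S (\<lambda>e f. c * g e f) = c * S g" for g h c
    by (simp_all add: S_def sum.distrib sum_subtractf sum_distrib_left)
  have expand: "- 1/4 * ((v e f - v f e + t e f) * (u e f + u f e - s e f))
        + 1/2 * (u e f * (v f e - v e f + t e f))
      = 1/4 * (v f e * u f e - v e f * u e f) + 1/4 * (v f e * u e f - v e f * u f e)
        + 1/4 * (v e f * s e f - v f e * s e f) + 1/4 * (t e f * u e f - t e f * u f e)
        - 1/2 * (u e f * v e f) + 1/4 * (s e f * t e f) + 1/2 * (u e f * v f e)" for e f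
    by (simp add: field_simps)
  have "S (\<lambda>e f. v f e * u f e) = S (\<lambda>e f. v e f * u e f)"
    and "S (\<lambda>e f. v f e * u e f) = S (\<lambda>e f. v e f * u f e)"
    and "S (\<lambda>e f. v f e * s e f) = S (\<lambda>e f. v e f * s e f)"
    and "S (\<lambda>e f. t e f * u f e) = S (\<lambda>e f. t e f * u e f)"
    and "S (\<lambda>e f. u e f * v f e) = S (\<lambda>e f. u f e * v e f)"
    by (subst swap, simp add: s t)+
  then have "S (\<lambda>e f. - 1/4 * ((v e f - v f e + t e f) * (u e f + u f e - s e f))
            + 1/2 * (u e f * (v f e - v e f + t e f)))
    = - 1/2 * S (\<lambda>e f. u e f * v e f) + 1/4 * S (\<lambda>e f. s e f * t e f)
      + 1/2 * S (\<lambda>e f. u f e * v e f)"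
    unfolding expand add diff scale by simp
  then show ?thesis by (simp only: S_def)
qed

context fd_metric_jordan_algebra
begin

abbreviation D where "D \<equiv> jordan_levi_civita mul"

lemma levi_civita_bilinear: "bilinear D"
  and levi_civita_symmetrization: "D x y + D y x = mul x y"
  and levi_civita_self_adjoint: "D x y \<bullet> z = y \<bullet> D x z"
  using jordan_levi_civita by (auto simp: is_jordan_levi_civita_def)

lemma linear_jordan_curvature: "linear (\<lambda>x. jordan_curvature mul u x v)"
  unfolding jordan_curvature_def Let_def
  by (rule linearI)
    (simp_all add: bilinear_ladd[OF levi_civita_bilinear] bilinear_radd[OF levi_civita_bilinear]
      bilinear_lmul[OF levi_civita_bilinear] bilinear_rmul[OF levi_civita_bilinear]
      bilinear_radd[OF bilinear_mul] bilinear_rmul[OF bilinear_mul] algebra_simps)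

lemma killing_form_orthonormal:
  assumes E: "orthonormal_basis E"
  shows "killing_form mul x y = (\<Sum>e\<in>E. \<Sum>f\<in>E. (mul x f \<bullet> e) * (mul y e \<bullet> f))"
proof -
  have lin: "linear (mul x)" for x
    using bilinear_mul by (simp add: bilinear_def)
  have "mul x (mul y e) \<bullet> e = (\<Sum>f\<in>E. (mul x f \<bullet> e) * (mul y e \<bullet> f))" for e
  proof -
    have "mul x (mul y e) = mul x (\<Sum>f\<in>E. (mul y e \<bullet> f) *\<^sub>R f)"
      by (simp add: orthonormal_basis_expand_inner[OF finite_dim E])
    then show ?thesis
      by (simp add: linear_sum[OF lin] linear_scale[OF lin] inner_sum_left mult.commute)
  qed
  then show ?thesis
    by (simp add: killing_form_def endo_trace_orthonormal[OF finite_dim linear_compose[OF lin lin] E])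
qed

text \<open>
  The explicit formula describes single applications of \<open>D\<close> only. In the two iterated terms
  self-adjointness moves the outer operator to the other side of the inner product; in the third
  term \<open>u e\<close> is expanded in the basis so that \<open>D\<close> is taken along basis vectors.
\<close>

lemma inner_jordan_curvature:
  assumes E: "orthonormal_basis E"
  shows "jordan_curvature mul u e v \<bullet> e =
    (\<Sum>f\<in>E. - 1/4 * ((mul v e \<bullet> f - mul v f \<bullet> e + mul e f \<bullet> v)
                        * (mul u e \<bullet> f + mul u f \<bullet> e - mul e f \<bullet> u))
           + 1/2 * ((mul u e \<bullet> f) * (mul v f \<bullet> e - mul v e \<bullet> f + mul e f \<bullet> v)))
    - 1/2 * (mul e e \<bullet> D u v)"
proof -
  have De: "D e v \<bullet> f = 1/2 * (mul v e \<bullet> f - mul v f \<bullet> e + mul e f \<bullet> v)"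
    and Du: "D u e \<bullet> f = 1/2 * (mul u e \<bullet> f + mul u f \<bullet> e - mul e f \<bullet> u)"
    and Df: "D f v \<bullet> e = 1/2 * (mul v f \<bullet> e - mul v e \<bullet> f + mul e f \<bullet> v)" for f
    by (simp_all add: jordan_levi_civita_explicit commute[of e v] commute[of f e] commute[of f u]
        commute[of f v])
  have "D u (D e v) \<bullet> e = D e v \<bullet> D u e"
    by (rule levi_civita_self_adjoint)
  also have "\<dots> = (\<Sum>f\<in>E. (D e v \<bullet> f) * (D u e \<bullet> f))"
    by (rule inner_orthonormal_expansion[OF finite_dim E])
  also have "\<dots> = (\<Sum>f\<in>E. 1/4 * ((mul v e \<bullet> f - mul v f \<bullet> e + mul e f \<bullet> v)
                        * (mul u e \<bullet> f + mul u f \<bullet> e - mul e f \<bullet> u)))"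
    by (simp add: De Du)
  finally have first: "D u (D e v) \<bullet> e = \<dots>" .
  have "D e (D u v) \<bullet> e = D e e \<bullet> D u v"
    by (simp add: levi_civita_self_adjoint inner_commute)
  moreover have "mul e e = 2 *\<^sub>R D e e"
    using levi_civita_symmetrization[of e e] by (simp add: scaleR_2)
  ultimately have second: "D e (D u v) \<bullet> e = 1/2 * (mul e e \<bullet> D u v)"
    by simp
  have lin: "linear (\<lambda>x. D x v)"
    using levi_civita_bilinear by (simp add: bilinear_def)
  have "D (mul u e) v = D (\<Sum>f\<in>E. (mul u e \<bullet> f) *\<^sub>R f) v"
    by (simp add: orthonormal_basis_expand_inner[OF finite_dim E])
  then have "D (mul u e) v \<bullet> e = (\<Sum>f\<in>E. (mul u e \<bullet> f) * (D f v \<bullet> e))"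
    by (simp add: linear_sum[OF lin] linear_scale[OF lin] inner_sum_left)
  also have "\<dots> = (\<Sum>f\<in>E. 1/2 * ((mul u e \<bullet> f) * (mul v f \<bullet> e - mul v e \<bullet> f + mul e f \<bullet> v)))"
    by (simp add: Df)
  finally have third: "D (mul u e) v \<bullet> e = \<dots>" .
  have "jordan_curvature mul u e v \<bullet> e
      = - (D u (D e v) \<bullet> e) - D e (D u v) \<bullet> e + D (mul u e) v \<bullet> e"
    by (simp add: jordan_curvature_def Let_def inner_add_left inner_diff_left)
  then show ?thesis
    unfolding first second third by (simp add: sum.distrib sum_negf sum_subtractf)
qed

lemma jordan_ric_eq:
  assumes E: "orthonormal_basis E"
  shows "jordan_ric mul u v =
      - 1/2 * (\<Sum>e\<in>E. \<Sum>f\<in>E. (mul u e \<bullet> f) * (mul v e \<bullet> f))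
      + 1/4 * (\<Sum>e\<in>E. \<Sum>f\<in>E. (mul e f \<bullet> u) * (mul e f \<bullet> v))
      + 1/2 * killing_form mul u v
      - 1/2 * (mean_curvature mul \<bullet> D u v)"
proof -
  have mean: "(\<Sum>e\<in>E. 1/2 * (mul e e \<bullet> D u v)) = 1/2 * (mean_curvature mul \<bullet> D u v)"
    by (simp add: mean_curvature_eq[OF E] inner_sum_left sum_distrib_left)
  have sym: "mul e f \<bullet> x = mul f e \<bullet> x" for e f x
    by (simp add: commute)
  show ?thesis
    unfolding jordan_ric_def endo_trace_orthonormal[OF finite_dim linear_jordan_curvature E]
      inner_jordan_curvature[OF E] sum_subtractf mean killing_form_orthonormal[OF E]
    by (subst sum_matrix_cancellation[where u = "\<lambda>e f. mul u e \<bullet> f" and v = "\<lambda>e f. mul v e \<bullet> f"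
          and s = "\<lambda>e f. mul e f \<bullet> u" and t = "\<lambda>e f. mul e f \<bullet> v", OF sym sym]) (rule refl)
qed

lemma killing_form_sym: "killing_form mul x y = killing_form mul y x"
proof -
  obtain E :: "'a set" where E: "orthonormal_basis E"
    using ex_orthonormal_basis[OF finite_dim] by blast
  show ?thesis
    unfolding killing_form_orthonormal[OF E] by (subst sum.swap) (simp add: mult.commute)
qed

end

theorem theorem3p18:
  fixes mul :: "'a::real_inner \<Rightarrow> 'a \<Rightarrow> 'a" and E :: "'a set" and X Y :: 'a
  assumes "fd_metric_jordan_algebra mul"
    and "orthonormal_basis E"
  shows "jordan_Ricci mul X Y =
      - 1/2 * (\<Sum>e\<in>E. \<Sum>f\<in>E. (mul X e \<bullet> f) * (mul Y e \<bullet> f))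
      + 1/4 * (\<Sum>e\<in>E. \<Sum>f\<in>E. (mul e f \<bullet> X) * (mul e f \<bullet> Y))
      + 1/2 * killing_form mul X Y
      - 1/4 * (mean_curvature mul \<bullet> mul X Y)"
proof -
  interpret fd_metric_jordan_algebra mul by fact
  have "mean_curvature mul \<bullet> mul X Y = mean_curvature mul \<bullet> D X Y + mean_curvature mul \<bullet> D Y X"
    by (simp flip: levi_civita_symmetrization add: inner_add_right)
  moreover have "(\<Sum>e\<in>E. \<Sum>f\<in>E. (mul Y e \<bullet> f) * (mul X e \<bullet> f))
      = (\<Sum>e\<in>E. \<Sum>f\<in>E. (mul X e \<bullet> f) * (mul Y e \<bullet> f))"
    "(\<Sum>e\<in>E. \<Sum>f\<in>E. (mul e f \<bullet> Y) * (mul e f \<bullet> X))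
      = (\<Sum>e\<in>E. \<Sum>f\<in>E. (mul e f \<bullet> X) * (mul e f \<bullet> Y))"
    by (simp_all add: mult.commute)
  ultimately show ?thesis
    unfolding jordan_Ricci_def jordan_ric_eq[OF assms(2)] killing_form_sym[of Y X]
    by (simp add: field_simps)
qed

end
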